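(* Let $G$ be a connected simple graph with $n$ vertices and $m$ edges, with maximum vertex degree $\Delta(G)$ and minimum vertex degree $\delta(G)$, and let $q(G)$ denote the largest eigenvalue of its signless Laplacian matrix. Then $$q(G)\le \frac{2m}{n}+\frac{\sqrt{(n-1)\big(8mn+n^2(\Delta(G)-\delta(G))^2\big)}}{2n},$$ with equality if and only if $G\cong K_n$.
   Context: The signless Laplacian matrix of $G$ is $Q(G)=D(G)+A(G)$, where $A(G)$ is the adjacency matrix and $D(G)$ the diagonal matrix of vertex degrees; $q(G)$ is called the $Q$-index. $K_n$ is the complete graph on $n$ vertices. *)

theory Defs
  imports
    "Graph_Theory.Graph_Theory"
    "Jordan_Normal_Form.Spectral_Radius"
begin

text \<open>
  Finite simple graphs are the symmetric, loop-free digraphs without parallel arcs of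
  the locale \<^locale>\<open>graph\<close>: an undirected edge \<open>{u, v}\<close> is represented by the two arcs
  from \<open>u\<close> to \<open>v\<close> and from \<open>v\<close> to \<open>u\<close>. Hence the number of edges is not the number of
  arcs, whereas the degree of a vertex is its out-degree.
\<close>

definition num_edges :: "('a, 'b) pre_digraph \<Rightarrow> nat" where
  "num_edges G = card {{u, v} | u v. u \<rightarrow>\<^bsub>G\<^esub> v}"

definition max_degree :: "('a, 'b) pre_digraph \<Rightarrow> nat" where
  "max_degree G = Max (out_degree G ` verts G)"

definition min_degree :: "('a, 'b) pre_digraph \<Rightarrow> nat" where
  "min_degree G = Min (out_degree G ` verts G)"

text \<open>
  The matrices of a graph are taken with respect to an enumeration \<open>vs\<close> of its vertices,
  that is, a distinct list with \<open>set vs = verts G\<close>.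
\<close>

definition adjacency_mat :: "('a, 'b) pre_digraph \<Rightarrow> 'a list \<Rightarrow> real mat" where
  "adjacency_mat G vs =
     mat (length vs) (length vs) (\<lambda>(i, j). if vs ! i \<rightarrow>\<^bsub>G\<^esub> vs ! j then 1 else 0)"

definition degree_mat :: "('a, 'b) pre_digraph \<Rightarrow> 'a list \<Rightarrow> real mat" where
  "degree_mat G vs =
     mat (length vs) (length vs) (\<lambda>(i, j). if i = j then real (out_degree G (vs ! i)) else 0)"

definition signless_laplacian :: "('a, 'b) pre_digraph \<Rightarrow> 'a list \<Rightarrow> real mat" where
  "signless_laplacian G vs = degree_mat G vs + adjacency_mat G vs"

text \<open>
  The matrix is real symmetric, so for a nonempty vertex set its real spectrum is finite and
  nonempty and contains all its eigenvalues; the maximum is therefore meaningful. Different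
  enumerations give permutation-similar matrices, hence the same value.
\<close>

definition Q_index :: "('a, 'b) pre_digraph \<Rightarrow> 'a list \<Rightarrow> real" where
  "Q_index G vs = Max (spectrum (signless_laplacian G vs))"

end

theory Submission
  imports Defs
begin

text \<open>
  Let \<open>x\<close> be a unit eigenvector of \<open>Q\<close> for the eigenvalue \<open>q\<close> and put
  \<open>t = (tr Q - q) / (n - 1)\<close>. The squared Frobenius norm of \<open>Q - (q - t) x x\<^sup>T - t I\<close> equals
  \<open>tr Q\<^sup>2 - q\<^sup>2 - (tr Q - q)\<^sup>2 / (n - 1)\<close>. Here \<open>tr Q = 2 m\<close>, while \<open>tr Q\<^sup>2\<close> is \<open>2 m\<close> plus the sum of the
  squared degrees, which Popoviciu's inequality bounds by means of the extreme degrees. That the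
  norm is nonnegative gives a quadratic inequality in \<open>q\<close>, and the bound is its larger root.
  In the case of equality the norm vanishes, so the off-diagonal entries of \<open>Q\<close> are
  \<open>(q - t) x\<^sub>u x\<^sub>v\<close>; since every vertex has a neighbour, none of them is zero and the graph
  is complete.
\<close>

section \<open>Real eigenvalues of symmetric matrices\<close>

lemma eigenvector_iff_sum:
  fixes A :: "'a :: comm_ring_1 mat"
  assumes "A \<in> carrier_mat n n"
  shows "eigenvector A v k \<longleftrightarrow> v \<in> carrier_vec n \<and> (\<exists>i<n. v $ i \<noteq> 0) \<and>
    (\<forall>i<n. (\<Sum>j<n. A $$ (i, j) * v $ j) = k * v $ i)"
proof -
  have "A *\<^sub>v v = k \<cdot>\<^sub>v v \<longleftrightarrow> (\<forall>i<n. (\<Sum>j<n. A $$ (i, j) * v $ j) = k * v $ i)"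
    if "v \<in> carrier_vec n"
    using assms that
    by (auto simp: vec_eq_iff scalar_prod_def lessThan_atLeast0)
  moreover have "v \<noteq> 0\<^sub>v n \<longleftrightarrow> (\<exists>i<n. v $ i \<noteq> 0)" if "v \<in> carrier_vec n"
    using that by (auto simp: vec_eq_iff)
  ultimately show ?thesis
    using assms unfolding eigenvector_def by auto
qed

text \<open>Some complex eigenvalue exists, and symmetry forces it to be real; the real and
  imaginary parts of its eigenvector then both satisfy the real eigenvalue equation, and one of them
  is nonzero. This makes the \<open>Max\<close> in \<open>Q_index\<close> meaningful.\<close>

lemma spectrum_symmetric_nonempty:
  fixes A :: "real mat"
  assumes A: "A \<in> carrier_mat n n" and "n > 0"
    and sym: "\<And>i j. i < n \<Longrightarrow> j < n \<Longrightarrow> A $$ (i, j) = A $$ (j, i)"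
  shows "spectrum A \<noteq> {}"
proof -
  define B where "B = map_mat complex_of_real A"
  have B: "B \<in> carrier_mat n n"
    using A by (simp add: B_def)
  have BA: "B $$ (i, j) = complex_of_real (A $$ (i, j))" if "i < n" "j < n" for i j
    using A that by (simp add: B_def)
  obtain k v where ev: "eigenvector B v k"
    using spectrum_non_empty[OF B \<open>n > 0\<close>] by (auto simp: spectrum_def eigenvalue_def)
  then obtain i0 where i0: "i0 < n" "v $ i0 \<noteq> 0"
    and eq: "\<And>i. i < n \<Longrightarrow> (\<Sum>j<n. A $$ (i, j) * v $ j) = k * v $ i"
    using BA unfolding eigenvector_iff_sum[OF B] by auto
  \<comment> \<open>\<open>N\<close> is the squared norm of \<open>v\<close> and \<open>R\<close>
    its Hermitian form. The eigenvalue equation gives \<open>R = k * N\<close>, while conjugating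
    and swapping the indices gives \<open>cnj R = R\<close>.\<close>
  define N where "N = (\<Sum>i<n. (cmod (v $ i))\<^sup>2)"
  define R where "R = (\<Sum>i<n. \<Sum>j<n. A $$ (i, j) * (cnj (v $ i) * v $ j))"
  have "N > 0"
    unfolding N_def using i0 by (intro sum_pos2[of _ i0]) auto
  have "R = (\<Sum>i<n. cnj (v $ i) * (\<Sum>j<n. A $$ (i, j) * v $ j))"
    by (simp add: R_def sum_distrib_left algebra_simps)
  also have "\<dots> = (\<Sum>i<n. k * of_real ((cmod (v $ i))\<^sup>2))"
    by (intro sum.cong refl) (auto simp: eq complex_norm_square simp del: of_real_power)
  also have "\<dots> = k * of_real N"
    by (simp add: N_def sum_distrib_left)
  finally have R: "R = k * of_real N" .
  have "cnj R = (\<Sum>i<n. \<Sum>j<n. A $$ (i, j) * (v $ i * cnj (v $ j)))"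
    by (simp add: R_def)
  also have "\<dots> = (\<Sum>j<n. \<Sum>i<n. A $$ (i, j) * (v $ i * cnj (v $ j)))"
    by (rule sum.swap)
  also have "\<dots> = R"
    unfolding R_def by (intro sum.cong refl) (auto simp: sym algebra_simps)
  finally have "cnj k = k"
    using R \<open>N > 0\<close> by auto
  then obtain r where r: "k = of_real r"
    by (metis Reals_cnj_iff Reals_cases)
  have Re: "(\<Sum>j<n. A $$ (i, j) * Re (v $ j)) = r * Re (v $ i)" if "i < n" for i
    using arg_cong[OF eq[OF that], of Re] by (simp add: r)
  have Im: "(\<Sum>j<n. A $$ (i, j) * Im (v $ j)) = r * Im (v $ i)" if "i < n" for i
    using arg_cong[OF eq[OF that], of Im] by (simp add: r)
  have "\<exists>w. eigenvector A w r"
  proof (cases "Re (v $ i0) = 0")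
    case True
    then have "Im (v $ i0) \<noteq> 0"
      using i0 by (auto simp: complex_eq_iff)
    then have "eigenvector A (vec n (\<lambda>i. Im (v $ i))) r"
      unfolding eigenvector_iff_sum[OF A] using i0 Im by auto
    then show ?thesis ..
  next
    case False
    then have "eigenvector A (vec n (\<lambda>i. Re (v $ i))) r"
      unfolding eigenvector_iff_sum[OF A] using i0 Re by auto
    then show ?thesis ..
  qed
  then show ?thesis
    by (auto simp: spectrum_def eigenvalue_def)
qed

section \<open>The Frobenius norm identity and Popoviciu's inequality\<close>

text \<open>
  The matrix \<open>(q - t) x x\<^sup>T + t I\<close> is the one with the same eigenvector \<open>x\<close>, the same
  eigenvalue \<open>q\<close> and the same trace whose other eigenvalues all coincide.
\<close>

lemma sum_squares_deviation:
  fixes a :: "'a \<Rightarrow> 'a \<Rightarrow> real"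
  assumes "finite V" and "card V \<noteq> 1"
    and eig: "\<And>u. u \<in> V \<Longrightarrow> (\<Sum>v\<in>V. a u v * x v) = q * x u"
    and unit: "(\<Sum>u\<in>V. (x u)\<^sup>2) = 1"
  defines "t \<equiv> ((\<Sum>u\<in>V. a u u) - q) / (real (card V) - 1)"
  shows "(\<Sum>u\<in>V. \<Sum>v\<in>V. (a u v - ((q - t) * x u * x v + t * of_bool (u = v)))\<^sup>2)
    = (\<Sum>u\<in>V. \<Sum>v\<in>V. (a u v)\<^sup>2) - q\<^sup>2 - ((\<Sum>u\<in>V. a u u) - q)\<^sup>2 / (real (card V) - 1)"
proof -
  define T where "T = (\<Sum>u\<in>V. a u u)"
  define N where "N = real (card V)"
  define c where "c = q - t"
  have N1: "N - 1 \<noteq> 0"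
    using \<open>card V \<noteq> 1\<close> by (auto simp: N_def)
  have aa: "(\<Sum>u\<in>V. \<Sum>v\<in>V. a u v * (x u * x v)) = q"
  proof -
    have "(\<Sum>u\<in>V. \<Sum>v\<in>V. a u v * (x u * x v)) = (\<Sum>u\<in>V. x u * (\<Sum>v\<in>V. a u v * x v))"
      by (simp add: sum_distrib_left algebra_simps)
    also have "\<dots> = (\<Sum>u\<in>V. q * (x u)\<^sup>2)"
      by (intro sum.cong refl) (auto simp: eig power2_eq_square)
    finally show ?thesis
      using unit by (simp flip: sum_distrib_left)
  qed
  have xx: "(\<Sum>u\<in>V. \<Sum>v\<in>V. (x u)\<^sup>2 * (x v)\<^sup>2) = 1"
    using unit by (simp flip: sum_distrib_left)
  have diag: "(\<Sum>u\<in>V. \<Sum>v\<in>V. f u v * of_bool (u = v)) = (\<Sum>u\<in>V. f u u)" for f :: "'a \<Rightarrow> 'a \<Rightarrow> real"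
    using \<open>finite V\<close> by (intro sum.cong refl) (simp add: of_bool_def if_distrib sum.delta cong: if_cong)
  \<comment> \<open>Since \<open>of_bool\<close> is idempotent, every term of the expanded square
    that involves \<open>t\<close> lives on the diagonal and is collected there.\<close>
  have "(\<Sum>u\<in>V. \<Sum>v\<in>V. (a u v - (c * x u * x v + t * of_bool (u = v)))\<^sup>2)
    = (\<Sum>u\<in>V. \<Sum>v\<in>V. (a u v)\<^sup>2 - 2 * c * (a u v * (x u * x v)) + c\<^sup>2 * ((x u)\<^sup>2 * (x v)\<^sup>2)
        + (t\<^sup>2 - 2 * t * a u v + 2 * t * c * (x u * x v)) * of_bool (u = v))"
    by (intro sum.cong refl) (auto simp: power2_eq_square algebra_simps)
  also have "\<dots> = (\<Sum>u\<in>V. \<Sum>v\<in>V. (a u v)\<^sup>2) - 2 * c * q + c\<^sup>2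
        + (\<Sum>u\<in>V. t\<^sup>2 - 2 * t * a u u + 2 * t * c * (x u)\<^sup>2)"
    using aa xx
    by (simp only: sum.distrib sum_subtractf diag flip: sum_distrib_left)
      (simp add: power2_eq_square sum.distrib sum_subtractf flip: sum_distrib_left)
  also have "(\<Sum>u\<in>V. t\<^sup>2 - 2 * t * a u u + 2 * t * c * (x u)\<^sup>2) = N * t\<^sup>2 - 2 * t * T + 2 * t * c"
    using unit by (simp add: sum.distrib sum_subtractf N_def T_def flip: sum_distrib_left)
  finally have "(\<Sum>u\<in>V. \<Sum>v\<in>V. (a u v - (c * x u * x v + t * of_bool (u = v)))\<^sup>2)
    = (\<Sum>u\<in>V. \<Sum>v\<in>V. (a u v)\<^sup>2) - q\<^sup>2 + (t * (t * (N - 1)) - 2 * t * (T - q))"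
    by (simp add: c_def power2_eq_square algebra_simps)
  \<comment> \<open>By the choice of \<open>t\<close>, the last bracket collapses to
    \<open>- t * (T - q)\<close>.\<close>
  moreover have "t * (N - 1) = T - q" and "t * (T - q) = (T - q)\<^sup>2 / (N - 1)"
    using N1 by (simp_all add: t_def T_def N_def power2_eq_square)
  ultimately have "(\<Sum>u\<in>V. \<Sum>v\<in>V. (a u v - (c * x u * x v + t * of_bool (u = v)))\<^sup>2)
    = (\<Sum>u\<in>V. \<Sum>v\<in>V. (a u v)\<^sup>2) - q\<^sup>2 - (T - q)\<^sup>2 / (N - 1)"
    by simp
  then show ?thesis
    unfolding c_def T_def N_def .
qed

text \<open>Popoviciu's bound on the variance, cleared of denominators. Each product
  \<open>(f v - lo) * (hi - f v)\<close> is nonnegative; summing these gives a bound linear in the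
  sum of \<open>f\<close>, and completing the square finishes.\<close>

lemma sum_power2_le_range:
  fixes f :: "'a \<Rightarrow> real"
  assumes "finite V" and "\<And>v. v \<in> V \<Longrightarrow> lo \<le> f v" and "\<And>v. v \<in> V \<Longrightarrow> f v \<le> hi"
  shows "real (card V) * (\<Sum>v\<in>V. (f v)\<^sup>2)
    \<le> (\<Sum>v\<in>V. f v)\<^sup>2 + (real (card V))\<^sup>2 * (hi - lo)\<^sup>2 / 4"
proof -
  define N where "N = real (card V)"
  define S where "S = (\<Sum>v\<in>V. f v)"
  have "(\<Sum>v\<in>V. (f v)\<^sup>2) \<le> (\<Sum>v\<in>V. (hi + lo) * f v - lo * hi)"
  proof (intro sum_mono)
    fix v assume "v \<in> V"
    then have "0 \<le> (f v - lo) * (hi - f v)"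
      using assms by simp
    then show "(f v)\<^sup>2 \<le> (hi + lo) * f v - lo * hi"
      by (simp add: algebra_simps power2_eq_square)
  qed
  also have "\<dots> = (hi + lo) * S - N * (lo * hi)"
    by (simp add: sum_subtractf S_def N_def sum_distrib_left)
  finally have "N * (\<Sum>v\<in>V. (f v)\<^sup>2) \<le> N * ((hi + lo) * S - N * (lo * hi))"
    by (rule mult_left_mono) (simp add: N_def)
  \<comment> \<open>The subtracted square measures how far the mean lies from the midpoint of the
    range; it is then discarded.\<close>
  also have "\<dots> = S\<^sup>2 + N\<^sup>2 * (hi - lo)\<^sup>2 / 4 - (S - N * (hi + lo) / 2)\<^sup>2"
    by (simp add: field_simps power2_eq_square)
  finally show ?thesis
    unfolding S_def N_def by (smt (verit) zero_le_power2)
qed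

section \<open>Adjacency, degrees and edge counting\<close>

context graph
begin

lemma dominates_sym: "u \<rightarrow>\<^bsub>G\<^esub> v \<longleftrightarrow> v \<rightarrow>\<^bsub>G\<^esub> u"
  using arcs_ends_symmetric[OF sym_arcs] by blast

text \<open>As there are no parallel arcs, an arc leaving \<open>u\<close> is determined by its
  head.\<close>

lemma out_degree_eq_card: "out_degree G u = card {v. u \<rightarrow>\<^bsub>G\<^esub> v}"
proof -
  have "bij_betw (head G) (out_arcs G u) {v. u \<rightarrow>\<^bsub>G\<^esub> v}"
  proof (rule bij_betw_imageI)
    show "inj_on (head G) (out_arcs G u)"
      by (auto intro!: inj_onI no_multi_arcs simp: arc_to_ends_def)
    show "head G ` out_arcs G u = {v. u \<rightarrow>\<^bsub>G\<^esub> v}"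
      by (auto simp: arcs_ends_conv)
  qed
  then show ?thesis
    unfolding out_degree_def by (rule bij_betw_same_card)
qed

lemma out_degree_eq_sum: "real (out_degree G u) = (\<Sum>v\<in>verts G. of_bool (u \<rightarrow>\<^bsub>G\<^esub> v))"
proof -
  have "{v. u \<rightarrow>\<^bsub>G\<^esub> v} = {v \<in> verts G. u \<rightarrow>\<^bsub>G\<^esub> v}"
    using adj_in_verts by blast
  then show ?thesis
    by (simp add: out_degree_eq_card of_bool_def sum.If_cases Int_def)
qed

text \<open>Handshake lemma, by counting adjacent ordered pairs twice: by first component, and by
  the fibres of the map to unordered pairs. Each fibre consists of the two orientations of an edge,
  which differ because there are no loops.\<close>

lemma sum_out_degree: "(\<Sum>u\<in>verts G. out_degree G u) = 2 * num_edges G"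
proof -
  define E where "E = arcs_ends G"
  have finE: "finite E"
    by (simp add: E_def arcs_ends_def)
  have "(\<Sum>u\<in>verts G. out_degree G u) = card (SIGMA u:verts G. {v. u \<rightarrow>\<^bsub>G\<^esub> v})"
  proof -
    have "finite {v. u \<rightarrow>\<^bsub>G\<^esub> v}" for u
      by (rule finite_subset[of _ "verts G"]) (auto dest: adj_in_verts)
    then show ?thesis
      by (simp add: out_degree_eq_card card_SigmaI)
  qed
  also have "(SIGMA u:verts G. {v. u \<rightarrow>\<^bsub>G\<^esub> v}) = E"
    by (auto simp: E_def dest: adj_in_verts)
  also have "card E = (\<Sum>e\<in>(\<lambda>(u, v). {u, v}) ` E. card {p \<in> E. (\<lambda>(u, v). {u, v}) p = e})"
    using sum.image_gen[OF finE, of "\<lambda>_. 1::nat" "\<lambda>(u, v). {u, v}"] by simp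
  also have "\<dots> = (\<Sum>e\<in>(\<lambda>(u, v). {u, v}) ` E. 2)"
  proof (intro sum.cong refl)
    fix e assume "e \<in> (\<lambda>(u, v). {u, v}) ` E"
    then obtain u v where uv: "e = {u, v}" "u \<rightarrow>\<^bsub>G\<^esub> v"
      by (auto simp: E_def)
    then have "u \<noteq> v" and "(u, v) \<in> E" and "(v, u) \<in> E"
      using adj_not_same dominates_sym unfolding E_def by blast+
    moreover have "{p \<in> E. (\<lambda>(u, v). {u, v}) p = e} = {(u, v), (v, u)}"
    proof (rule Set.set_eqI)
      fix p :: "'a \<times> 'a"
      show "p \<in> {p \<in> E. (\<lambda>(u, v). {u, v}) p = e} \<longleftrightarrow> p \<in> {(u, v), (v, u)}"
        unfolding uv(1) using \<open>(u, v) \<in> E\<close> \<open>(v, u) \<in> E\<close>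
        by (cases p) (simp add: doubleton_eq_iff, blast)
    qed
    ultimately show "card {p \<in> E. (\<lambda>(u, v). {u, v}) p = e} = 2"
      by simp
  qed
  also have "(\<lambda>(u, v). {u, v}) ` E = {{u, v} | u v. u \<rightarrow>\<^bsub>G\<^esub> v}"
    by (auto simp: E_def)
  finally show ?thesis
    by (simp add: num_edges_def)
qed

section \<open>Trace, norm and eigenvalues of the signless Laplacian\<close>

text \<open>Indexing by vertices instead of positions keeps the spectral argument independent of the
  enumeration.\<close>

abbreviation signless_entry :: "'a \<Rightarrow> 'a \<Rightarrow> real" where
  "signless_entry u v \<equiv> real (out_degree G u) * of_bool (u = v) + of_bool (u \<rightarrow>\<^bsub>G\<^esub> v)"

lemma sum_signless_entry_power2:
  "(\<Sum>u\<in>verts G. \<Sum>v\<in>verts G. (signless_entry u v)\<^sup>2)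
    = (\<Sum>u\<in>verts G. (real (out_degree G u))\<^sup>2) + 2 * real (num_edges G)"
proof -
  have "(\<Sum>v\<in>verts G. (signless_entry u v)\<^sup>2) = (real (out_degree G u))\<^sup>2 + real (out_degree G u)"
    if "u \<in> verts G" for u
  proof -
    \<comment> \<open>The cross term vanishes because no vertex is adjacent to itself.\<close>
    have "(signless_entry u v)\<^sup>2
        = (if u = v then (real (out_degree G u))\<^sup>2 else 0) + of_bool (u \<rightarrow>\<^bsub>G\<^esub> v)" for v
      using adj_not_same[of u] by auto
    then show ?thesis
      using that by (simp add: sum.distrib sum.delta out_degree_eq_sum)
  qed
  then show ?thesis
    using arg_cong[OF sum_out_degree, of real] by (simp add: sum.distrib)
qed

lemma sum_signless_entry_diag:
  "(\<Sum>u\<in>verts G. signless_entry u u) = 2 * real (num_edges G)"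
proof -
  have "(\<Sum>u\<in>verts G. signless_entry u u) = (\<Sum>u\<in>verts G. real (out_degree G u))"
    using adj_not_same by (intro sum.cong refl) auto
  then show ?thesis
    using arg_cong[OF sum_out_degree, of real] by simp
qed

lemma sum_out_degree_power2_le:
  "real (card (verts G)) * (\<Sum>u\<in>verts G. (real (out_degree G u))\<^sup>2)
    \<le> (2 * real (num_edges G))\<^sup>2
      + (real (card (verts G)))\<^sup>2 * (real (max_degree G) - real (min_degree G))\<^sup>2 / 4"
proof -
  have "(\<Sum>u\<in>verts G. real (out_degree G u)) = 2 * real (num_edges G)"
    using arg_cong[OF sum_out_degree, of real] by simp
  then show ?thesis
    using sum_power2_le_range[of "verts G" "real (min_degree G)" "\<lambda>u. real (out_degree G u)"
        "real (max_degree G)"]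
    by (simp add: max_degree_def min_degree_def)
qed

text \<open>The right-hand side is a positive multiple of the gap between the squared radius of the
  bound and the squared distance of \<open>q\<close> from \<open>2 * m / n\<close>. Nonnegativity of
  the left-hand side therefore yields the bound, and its vanishing determines all entries. Only the
  shape of the approximating matrix matters afterwards, so \<open>c\<close>, \<open>t\<close> and
  \<open>y\<close> remain abstract.\<close>

lemma signless_eigenvalue_deviation:
  assumes card: "card (verts G) > 1" and "u0 \<in> verts G" and "x u0 \<noteq> 0"
    and eig: "\<And>u. u \<in> verts G \<Longrightarrow> (\<Sum>v\<in>verts G. signless_entry u v * x v) = q * x u"
  defines "n \<equiv> real (card (verts G))" and "m \<equiv> real (num_edges G)"
    and "D \<equiv> real (max_degree G) - real (min_degree G)"
  obtains c t y where
    "(\<Sum>u\<in>verts G. \<Sum>v\<in>verts G.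
        (signless_entry u v - (c * y u * y v + t * of_bool (u = v)))\<^sup>2)
      \<le> n / (n - 1) * ((n - 1) * (8 * m * n + n\<^sup>2 * D\<^sup>2) / (2 * n)\<^sup>2 - (q - 2 * m / n)\<^sup>2)"
proof -
  define N where "N = sqrt (\<Sum>u\<in>verts G. (x u)\<^sup>2)"
  define y where "y u = x u / N" for u
  define S where "S = (\<Sum>u\<in>verts G. (real (out_degree G u))\<^sup>2)"
  have "(\<Sum>u\<in>verts G. (x u)\<^sup>2) > 0"
    using assms by (intro sum_pos2[of _ u0]) auto
  then have N: "N > 0" "N\<^sup>2 = (\<Sum>u\<in>verts G. (x u)\<^sup>2)"
    by (simp_all add: N_def)
  have unit: "(\<Sum>u\<in>verts G. (y u)\<^sup>2) = 1"
    using N(1) by (simp add: y_def power_divide flip: sum_divide_distrib N(2))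
  have eig_y: "(\<Sum>v\<in>verts G. signless_entry u v * y v) = q * y u" if "u \<in> verts G" for u
    using eig[OF that] by (simp add: y_def flip: sum_divide_distrib)
  define t where "t = (2 * m - q) / (n - 1)"
  have n: "n > 1"
    using card by (simp add: n_def)
  have "(\<Sum>u\<in>verts G. \<Sum>v\<in>verts G.
      (signless_entry u v - ((q - t) * y u * y v + t * of_bool (u = v)))\<^sup>2)
    = S + 2 * m - q\<^sup>2 - (2 * m - q)\<^sup>2 / (n - 1)"
    using sum_squares_deviation[of "verts G" signless_entry y q, OF finite_verts _ eig_y unit] card
    unfolding sum_signless_entry_power2 sum_signless_entry_diag
    by (simp only: S_def m_def n_def t_def)
  \<comment> \<open>Popoviciu's inequality for the degrees, divided by \<open>n\<close>.\<close>
  also have "\<dots> \<le> (4 * m\<^sup>2 + n\<^sup>2 * D\<^sup>2 / 4) / n + 2 * m - q\<^sup>2 - (2 * m - q)\<^sup>2 / (n - 1)"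
    using sum_out_degree_power2_le n
    by (simp add: S_def m_def n_def D_def pos_le_divide_eq mult.commute power_mult_distrib)
  \<comment> \<open>Completing the square in \<open>q\<close>: the leading coefficient is
    \<open>- n / (n - 1)\<close>, the vertex is at \<open>2 * m / n\<close>, and the terms in the
    square of \<open>m\<close> cancel from the constant.\<close>
  also have "\<dots> = n / (n - 1) *
      ((n - 1) * (8 * m * n + n\<^sup>2 * D\<^sup>2) / (2 * n)\<^sup>2 - (q - 2 * m / n)\<^sup>2)"
    using n by (simp add: divide_simps power2_eq_square) (simp add: algebra_simps)
  finally show thesis
    by (rule that)
qed

section \<open>Complete graphs and connectedness\<close>

text \<open>Each row sums to twice the degree, so regularity makes the all-ones vector an
  eigenvector. This provides the eigenvalue that attains the bound.\<close>

lemma complete_signless_eigenvector: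
  assumes complete: "K\<^bsub>card (verts G)\<^esub> G" and u: "u \<in> verts G"
  shows "out_degree G u = card (verts G) - 1"
    and "(\<Sum>v\<in>verts G. signless_entry u v) = 2 * (real (card (verts G)) - 1)"
proof -
  have "{v. u \<rightarrow>\<^bsub>G\<^esub> v} = verts G - {u}"
    using complete u by (auto simp: complete_digraph_def)
  then show deg: "out_degree G u = card (verts G) - 1"
    using u by (simp add: out_degree_eq_card)
  have "card (verts G) \<ge> 1"
    using u by (metis One_nat_def Suc_leI card_gt_0_iff empty_iff finite_verts)
  moreover have "(\<Sum>v\<in>verts G. signless_entry u v) = 2 * real (out_degree G u)"
    using u by (simp add: sum.distrib out_degree_eq_sum[symmetric] flip: sum_distrib_left)
  ultimately show "(\<Sum>v\<in>verts G. signless_entry u v) = 2 * (real (card (verts G)) - 1)"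
    by (simp add: deg of_nat_diff)
qed

text \<open>Take the first arc of a path from \<open>u\<close> to some other vertex. In the equality
  case this rules out zero coordinates of the eigenvector.\<close>

lemma connected_imp_dominates:
  assumes "Digraph_Component.connected G" and "card (verts G) \<noteq> 1" and "u \<in> verts G"
  shows "\<exists>v. u \<rightarrow>\<^bsub>G\<^esub> v"
proof -
  have sc: "strongly_connected G"
    using assms(1) sym_arcs by (intro symmetric_connected_imp_strongly_connected)
  obtain v where "v \<in> verts G" "v \<noteq> u"
    using assms(2,3) by (metis is_singletonI' is_singleton_altdef empty_iff)
  then have "u \<rightarrow>\<^sup>*\<^bsub>G\<^esub> v"
    using sc assms(3) by blast
  then show ?thesis
    using \<open>v \<noteq> u\<close> by (cases rule: converse_reachable_cases) auto
qed

lemma complete_digraphI: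
  assumes "\<And>u v. u \<in> verts G \<Longrightarrow> v \<in> verts G \<Longrightarrow> u \<noteq> v \<Longrightarrow> u \<rightarrow>\<^bsub>G\<^esub> v"
  shows "K\<^bsub>card (verts G)\<^esub> G"
  unfolding complete_digraph_def
proof (intro conjI)
  show "graph G"
    by unfold_locales
  show "arcs_ends G = {(u, v). (u, v) \<in> verts G \<times> verts G \<and> u \<noteq> v}"
    using assms adj_in_verts adj_not_same by fast
qed simp

section \<open>Transfer between matrix positions and vertices\<close>

context
  fixes vs :: "'a list"
  assumes distinct: "distinct vs" and set_vs: "set vs = verts G"
begin

lemma signless_laplacian_carrier:
  "signless_laplacian G vs \<in> carrier_mat (length vs) (length vs)"
  by (simp add: signless_laplacian_def degree_mat_def adjacency_mat_def)

text \<open>Distinctness of \<open>vs\<close> identifies the test \<open>i = j\<close> on positions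
  with equality of vertices.\<close>

lemma signless_laplacian_entry:
  assumes "i < length vs" "j < length vs"
  shows "signless_laplacian G vs $$ (i, j) = signless_entry (vs ! i) (vs ! j)"
  using assms distinct
  by (simp add: signless_laplacian_def degree_mat_def adjacency_mat_def nth_eq_iff_index_eq)

lemma sum_nth_vs: "(\<Sum>i<length vs. f (vs ! i)) = sum f (verts G)"
  by (rule sum.reindex_bij_betw[OF bij_betw_nth[OF distinct refl set_vs[symmetric]]])

lemma mem_spectrum_signless_laplacian_iff:
  "q \<in> spectrum (signless_laplacian G vs) \<longleftrightarrow>
    (\<exists>x. (\<exists>u\<in>verts G. x u \<noteq> 0) \<and>
      (\<forall>u\<in>verts G. (\<Sum>v\<in>verts G. signless_entry u v * x v) = q * x u))"
  (is "?L \<longleftrightarrow> ?R")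
proof
  assume ?L
  then obtain w i0 where "i0 < length vs" "w $ i0 \<noteq> 0" and eq: "\<And>i. i < length vs \<Longrightarrow>
      (\<Sum>j<length vs. signless_laplacian G vs $$ (i, j) * w $ j) = q * w $ i"
    unfolding spectrum_def eigenvalue_def eigenvector_iff_sum[OF signless_laplacian_carrier]
    by auto
  \<comment> \<open>The vector is carried over to the vertices along the inverse of the
    enumeration.\<close>
  define x where "x v = w $ (the_inv_into {..<length vs} ((!) vs) v)" for v
  have x: "x (vs ! i) = w $ i" if "i < length vs" for i
    using that distinct by (simp add: x_def the_inv_into_f_f inj_on_nth)
  have "(\<Sum>v\<in>verts G. signless_entry u v * x v) = q * x u" if "u \<in> verts G" for u
  proof -
    from that have "u \<in> set vs"
      by (simp add: set_vs)
    then obtain i where i: "i < length vs" "u = vs ! i"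
      by (auto simp: in_set_conv_nth)
    have "(\<Sum>v\<in>verts G. signless_entry u v * x v)
        = (\<Sum>j<length vs. signless_laplacian G vs $$ (i, j) * w $ j)"
      unfolding sum_nth_vs[symmetric]
      by (intro sum.cong refl) (simp add: signless_laplacian_entry i x)
    then show ?thesis
      using eq i x by simp
  qed
  moreover have "vs ! i0 \<in> verts G" "x (vs ! i0) \<noteq> 0"
    using \<open>i0 < length vs\<close> \<open>w $ i0 \<noteq> 0\<close> x set_vs by auto
  ultimately show ?R by blast
next
  assume ?R
  then obtain x u0 where u0: "u0 \<in> verts G" "x u0 \<noteq> 0"
    and eq: "\<And>u. u \<in> verts G \<Longrightarrow> (\<Sum>v\<in>verts G. signless_entry u v * x v) = q * x u"
    by blast
  define w where "w = vec (length vs) (\<lambda>i. x (vs ! i))"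
  have "u0 \<in> set vs"
    using u0(1) by (simp add: set_vs)
  then obtain i0 where i0: "i0 < length vs" "u0 = vs ! i0"
    by (auto simp: in_set_conv_nth)
  have "(\<Sum>j<length vs. signless_laplacian G vs $$ (i, j) * w $ j) = q * w $ i"
    if "i < length vs" for i
  proof -
    have "(\<Sum>j<length vs. signless_laplacian G vs $$ (i, j) * w $ j)
        = (\<Sum>v\<in>verts G. signless_entry (vs ! i) v * x v)"
      unfolding sum_nth_vs[symmetric]
      by (intro sum.cong refl) (simp add: signless_laplacian_entry that w_def)
    then show ?thesis
      using eq[of "vs ! i"] that set_vs[symmetric] by (simp add: w_def)
  qed
  then have "eigenvector (signless_laplacian G vs) w q"
    unfolding eigenvector_iff_sum[OF signless_laplacian_carrier]
    using i0 u0(2) by (auto simp: w_def)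
  then show ?L
    by (auto simp: spectrum_def eigenvalue_def)
qed

lemma finite_spectrum_signless_laplacian: "finite (spectrum (signless_laplacian G vs))"
  by (rule card_finite_spectrum(1)[OF signless_laplacian_carrier])

lemma spectrum_signless_laplacian_nonempty:
  assumes "verts G \<noteq> {}"
  shows "spectrum (signless_laplacian G vs) \<noteq> {}"
  by (rule spectrum_symmetric_nonempty[OF signless_laplacian_carrier])
    (use assms set_vs dominates_sym in \<open>auto simp: signless_laplacian_entry\<close>)

lemma Q_index_mem_spectrum:
  assumes "verts G \<noteq> {}"
  shows "Q_index G vs \<in> spectrum (signless_laplacian G vs)"
  unfolding Q_index_def
  by (rule Max_in[OF finite_spectrum_signless_laplacian
        spectrum_signless_laplacian_nonempty[OF assms]])

lemma spectrum_le_Q_index: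
  "q \<in> spectrum (signless_laplacian G vs) \<Longrightarrow> q \<le> Q_index G vs"
  unfolding Q_index_def by (rule Max_ge[OF finite_spectrum_signless_laplacian])

end

end

section \<open>The bound and its equality case\<close>

theorem theorem3:
  fixes G :: "('a, 'b) pre_digraph" and vs :: "'a list" and n m :: nat
  assumes "graph G"
    and "Digraph_Component.connected G"
    and "distinct vs" and "set vs = verts G"
    and "n = card (verts G)"
    and "m = num_edges G"
  defines "bound \<equiv> 2 * real m / real n
      + sqrt ((real n - 1) * (8 * real m * real n
          + (real n)\<^sup>2 * (real (max_degree G) - real (min_degree G))\<^sup>2)) / (2 * real n)"
  shows "Q_index G vs \<le> bound \<and> (Q_index G vs = bound \<longleftrightarrow> K\<^bsub>n\<^esub> G)"
proof -
  interpret graph G by fact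
  define r where "r = sqrt ((real n - 1) * (8 * real m * real n
      + (real n)\<^sup>2 * (real (max_degree G) - real (min_degree G))\<^sup>2)) / (2 * real n)"
  have bound: "bound = 2 * real m / real n + r"
    by (simp add: bound_def r_def)
  \<comment> \<open>Nonemptiness of the vertex set is part of
    \<open>strongly_connected\<close>.\<close>
  have ne: "verts G \<noteq> {}"
    using symmetric_connected_imp_strongly_connected[OF sym_arcs assms(2)]
    by (auto simp: strongly_connected_def)
  then have "n \<ge> 1"
    using assms(5) by (simp add: Suc_leI card_gt_0_iff)
  then have "r \<ge> 0" and r2: "r\<^sup>2 = (real n - 1) * (8 * real m * real n
      + (real n)\<^sup>2 * (real (max_degree G) - real (min_degree G))\<^sup>2) / (2 * real n)\<^sup>2"
    by (simp_all add: r_def power_divide)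
  define q where "q = Q_index G vs"
  obtain x u0 where u0: "u0 \<in> verts G" "x u0 \<noteq> 0"
    and eig: "\<And>u. u \<in> verts G \<Longrightarrow> (\<Sum>v\<in>verts G. signless_entry u v * x v) = q * x u"
    using Q_index_mem_spectrum[OF assms(3,4) ne]
    unfolding q_def mem_spectrum_signless_laplacian_iff[OF assms(3,4)] by blast
  \<comment> \<open>For a complete graph only this direction is required, the other being the
    general bound. The degree spread is zero and \<open>2 * m = n * (n - 1)\<close>, so
    \<open>r = n - 1\<close> and the bound is \<open>2 * (n - 1)\<close>, an eigenvalue with the
    all-ones vector.\<close>
  have complete_le: "bound \<le> q" if "K\<^bsub>n\<^esub> G"
  proof -
    have complete: "K\<^bsub>card (verts G)\<^esub> G"
      using that assms(5) by simp
    have deg: "out_degree G u = n - 1" if "u \<in> verts G" for u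
      using complete_signless_eigenvector(1)[OF complete that] assms(5) by simp
    have "out_degree G ` verts G = {n - 1}"
      using deg ne by (auto simp: image_iff)
    then have "max_degree G = min_degree G"
      by (simp add: max_degree_def min_degree_def)
    moreover have "2 * m = n * (n - 1)"
      using sum_out_degree deg assms(5,6) by simp
    then have m: "2 * real m = real n * (real n - 1)"
      using \<open>n \<ge> 1\<close> by (metis of_nat_1 of_nat_diff of_nat_mult of_nat_numeral)
    moreover have eight: "8 * real m = 4 * (real n * (real n - 1))"
      using m by linarith
    ultimately have "r\<^sup>2 = (real n - 1)\<^sup>2"
      using \<open>n \<ge> 1\<close> unfolding r2 eight by (simp add: power2_eq_square divide_simps)
    then have "r = real n - 1"
      using \<open>r \<ge> 0\<close> \<open>n \<ge> 1\<close> by (simp add: power2_eq_iff_nonneg)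
    then have "bound = 2 * (real n - 1)"
      using m \<open>n \<ge> 1\<close> by (simp add: bound)
    moreover have "2 * (real n - 1) \<in> spectrum (signless_laplacian G vs)"
      unfolding mem_spectrum_signless_laplacian_iff[OF assms(3,4)]
      by (rule exI[of _ "\<lambda>_. 1"])
        (use ne complete_signless_eigenvector(2)[OF complete] assms(5) in auto)
    ultimately show ?thesis
      using spectrum_le_Q_index[OF assms(3,4)] by (simp add: q_def)
  qed
  show ?thesis
  \<comment> \<open>The deviation estimate divides by \<open>n - 1\<close>, so the single vertex is
    treated apart: there the matrix and the bound are zero and the graph is complete.\<close>
  proof (cases "n = 1")
    case True
    then have V: "verts G = {u0}"
      using u0(1) assms(5) by (metis card_1_singletonE singletonD)
    have "\<not> u0 \<rightarrow>\<^bsub>G\<^esub> v" for v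
      using V adj_in_verts(2)[of u0 v] adj_not_same[of u0] by auto
    then have "q = 0"
      using eig[of u0] u0 V by (simp add: out_degree_eq_card)
    moreover have "K\<^bsub>n\<^esub> G"
      using complete_digraphI assms(5) V by auto
    moreover have "m = 0"
      using sum_out_degree V \<open>\<And>v. \<not> u0 \<rightarrow>\<^bsub>G\<^esub> v\<close> assms(6) by (simp add: out_degree_eq_card)
    ultimately show ?thesis
      using True by (simp add: bound_def q_def)
  next
    case False
    then have "n > 1"
      using \<open>n \<ge> 1\<close> by simp
    then obtain c t y where dev: "(\<Sum>u\<in>verts G. \<Sum>v\<in>verts G.
        (signless_entry u v - (c * y u * y v + t * of_bool (u = v)))\<^sup>2)
      \<le> real n / (real n - 1) * (r\<^sup>2 - (q - 2 * real m / real n)\<^sup>2)"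
      using signless_eigenvalue_deviation[OF _ u0 eig] unfolding assms(5,6) r2 by blast
    have dev_nonneg: "0 \<le> (\<Sum>u\<in>verts G. \<Sum>v\<in>verts G.
        (signless_entry u v - (c * y u * y v + t * of_bool (u = v)))\<^sup>2)"
      by (intro sum_nonneg) auto
    have "real n / (real n - 1) > 0"
      using \<open>n > 1\<close> by simp
    then have "(q - 2 * real m / real n)\<^sup>2 \<le> r\<^sup>2"
      using order.trans[OF dev_nonneg dev] by (auto simp only: zero_le_mult_iff)
    then have "q \<le> bound"
      using \<open>r \<ge> 0\<close> by (auto simp: bound dest: power2_le_imp_le)
    moreover have "K\<^bsub>n\<^esub> G" if "q = bound"
    proof -
      \<comment> \<open>If \<open>q = bound\<close>, then \<open>q - 2 * m / n\<close> is exactly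
        \<open>r\<close>, so the estimate \<open>dev\<close> squeezes the norm to zero.\<close>
      have "(\<Sum>u\<in>verts G. \<Sum>v\<in>verts G.
          (signless_entry u v - (c * y u * y v + t * of_bool (u = v)))\<^sup>2) = 0"
        using dev dev_nonneg that by (simp add: bound)
      then have entry: "signless_entry u v = c * y u * y v + t * of_bool (u = v)"
        if "u \<in> verts G" "v \<in> verts G" for u v
        using that by (simp add: sum_nonneg_eq_0_iff sum_nonneg)
      \<comment> \<open>For a neighbour \<open>v\<close> of \<open>u\<close> the entry is 1 and off
        the diagonal, so \<open>c * y u * y v = 1\<close> and no factor is zero.\<close>
      have nz: "c \<noteq> 0 \<and> y u \<noteq> 0" if u: "u \<in> verts G" for u
      proof -
        obtain v where "u \<rightarrow>\<^bsub>G\<^esub> v"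
          using connected_imp_dominates[OF assms(2) _ u] False assms(5) by auto
        then show ?thesis
          using entry[OF u, of v] adj_in_verts(2)[of u v] adj_not_same[of u] by (cases "u = v") auto
      qed
      \<comment> \<open>A non-adjacent pair of distinct vertices would have entry 0, although
        \<open>c * y u * y v\<close> is nonzero.\<close>
      have "u \<rightarrow>\<^bsub>G\<^esub> v" if "u \<in> verts G" "v \<in> verts G" "u \<noteq> v" for u v
        using entry[of u v] nz[of u] nz[of v] that by (cases "u \<rightarrow>\<^bsub>G\<^esub> v") auto
      then show ?thesis
        using complete_digraphI assms(5) by simp
    qed
    ultimately show ?thesis
      using complete_le by (auto simp: q_def)
  qed
qed

end
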